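(* Let $n,k$ be nonnegative integers. Then $$\sum_{\pi\in \mathfrak{P}_{n,k}}q^{\mathsf{inv}(\pi)}=\left[{n\atop k}\right]^2[n-k]!.$$
   Context: A partial permutation of order $n$ is an $n\times n$ $(0,1)$-matrix $\pi=(\pi_{i,j})$ with at most one $1$ in each row and each column; $\mathfrak{P}_{n,k}$ is the set of those with exactly $k$ zero rows (for $n=0$ there is only the empty matrix, lying in $\mathfrak{P}_{0,0}$). $\mathsf{inv}(\pi)$: for each $1$ delete all entries to its right in its row and all entries below it in its column; $\mathsf{inv}(\pi)$ is the number of remaining $0$ entries that have a $1$ in their row or in their column (or both). $q$ is an indeterminate, $[n]=1+q+\cdots+q^{n-1}$, $[n]!=[1][2]\cdots[n]$ (with $[0]!=1$), and $\left[{n\atop k}\right]=\frac{[n]!}{[k]!\,[n-k]!}$. When $k>n$ the right-hand side is interpreted as $0$. *)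

theory Defs
  imports
    "Jordan_Normal_Form.Matrix"
    "HOL-Computational_Algebra.Polynomial_Factorial"
begin

text \<open>Matrix positions are 0-based: rows and columns are indexed by 0, ..., n - 1.\<close>

definition partial_perms :: "nat \<Rightarrow> nat \<Rightarrow> nat mat set" where
  "partial_perms n k =
     {A \<in> carrier_mat n n.
        (\<forall>i<n. \<forall>j<n. A $$ (i, j) \<in> {0, 1}) \<and>
        (\<forall>i<n. card {j. j < n \<and> A $$ (i, j) = 1} \<le> 1) \<and>
        (\<forall>j<n. card {i. i < n \<and> A $$ (i, j) = 1} \<le> 1) \<and>
        card {i. i < n \<and> row A i = 0\<^sub>v n} = k}"

definition deleted :: "nat mat \<Rightarrow> nat \<Rightarrow> nat \<Rightarrow> bool" where
  "deleted A i j \<longleftrightarrow> (\<exists>j'<j. A $$ (i, j') = 1) \<or> (\<exists>i'<i. A $$ (i', j) = 1)"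

text \<open>In a partial permutation no 1 is ever deleted, so whether the row or the column of an entry
  contains a 1 does not depend on the deletions.\<close>

definition pp_inv :: "nat mat \<Rightarrow> nat" where
  "pp_inv A = card {(i, j). i < dim_row A \<and> j < dim_col A \<and>
     A $$ (i, j) = 0 \<and> \<not> deleted A i j \<and>
     ((\<exists>j'<dim_col A. A $$ (i, j') = 1) \<or> (\<exists>i'<dim_row A. A $$ (i', j) = 1))}"

definition qint :: "'a::field \<Rightarrow> nat \<Rightarrow> 'a" where
  "qint q n = (\<Sum>i<n. q ^ i)"

definition qfact :: "'a::field \<Rightarrow> nat \<Rightarrow> 'a" where
  "qfact q n = (\<Prod>i=1..n. qint q i)"

definition qbinom :: "'a::field \<Rightarrow> nat \<Rightarrow> nat \<Rightarrow> 'a" where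
  "qbinom q n k = (if k \<le> n then qfact q n / (qfact q k * qfact q (n - k)) else 0)"

text \<open>The indeterminate q, as an element of the fraction field of the polynomials over the
  integers; the embedding of the polynomials into this field is injective.\<close>

definition indet :: "int poly fract" where
  "indet = to_fract [:0, 1:]"

text \<open>Needed for sums over \<^const>\<open>partial_perms\<close> not to default to 0.\<close>

lemma finite_partial_perms: "finite (partial_perms n k)"
proof -
  let ?I = "{0..<n} \<times> {0..<n}"
  let ?F = "{f. \<forall>x. (x \<in> ?I \<longrightarrow> f x \<in> {0, 1::nat}) \<and> (x \<notin> ?I \<longrightarrow> f x = 0)}"
  have "finite ?F"
    by (rule finite_set_of_finite_funs) auto
  moreover have "partial_perms n k \<subseteq> (\<lambda>f. mat n n f) ` ?F"
  proof
    fix A assume A: "A \<in> partial_perms n k"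
    let ?f = "\<lambda>x. if x \<in> ?I then A $$ x else 0"
    have "A = mat n n ?f"
      using A by (intro eq_matI) (auto simp: partial_perms_def)
    moreover have "?f \<in> ?F"
      using A by (auto simp: partial_perms_def)
    ultimately show "A \<in> (\<lambda>f. mat n n f) ` ?F"
      by blast
  qed
  ultimately show ?thesis
    by (rule finite_surj)
qed

end

(* Regard a partial permutation as a placement of r non-attacking rooks on a rectangular m x n
   board. Removing the last row, either this row is empty and inv is unchanged, or it carries a rook
   in one of the columns left free by the other rows, and inv drops by the number of other empty rows
   plus the number of free columns to the left of the rook. The generating function F therefore
   satisfies F (m+1, n, r+1) = F (m, n, r+1) + q^(m-r) [n-r] F (m, n, r), and
   [r]! F (m, n, r) is the product of the q-falling factorials of m and n of length r. *)

theory Submission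
  imports Defs
begin

section \<open>Rook placements, their inversions and generating function\<close>

text \<open>Non-attacking is encoded as injectivity of both projections, so that
  \<open>card_image\<close> counts the occupied rows and columns.\<close>

definition rook_placements :: "nat \<Rightarrow> nat \<Rightarrow> nat \<Rightarrow> (nat \<times> nat) set set" where
  "rook_placements m n r =
     {S. S \<subseteq> {..<m} \<times> {..<n} \<and> inj_on fst S \<and> inj_on snd S \<and> card S = r}"

text \<open>The bounds \<open>j' \<le> j\<close> and \<open>i' \<le> i\<close> are weak: they
  exclude at once the rooks themselves and every entry deleted by a rook to the left or
  above.\<close>

definition inversions :: "nat \<Rightarrow> nat \<Rightarrow> (nat \<times> nat) set \<Rightarrow> (nat \<times> nat) set" where
  "inversions m n S =
     {(i, j). i < m \<and> j < n \<and> (\<forall>j'\<le>j. (i, j') \<notin> S) \<and> (\<forall>i'\<le>i. (i', j) \<notin> S) \<and>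
        (i \<in> fst ` S \<or> j \<in> snd ` S)}"

definition rook_sum :: "'a::comm_semiring_1 \<Rightarrow> nat \<Rightarrow> nat \<Rightarrow> nat \<Rightarrow> 'a" where
  "rook_sum q m n r = (\<Sum>S\<in>rook_placements m n r. q ^ card (inversions m n S))"

text \<open>The q-falling factorial [n][n-1]...[n-r+1]. Truncated subtraction is harmless: for
  \<open>r > n\<close> the factor at \<open>i = n\<close> is \<open>qint q 0\<close>, which is
  0.\<close>

definition qfalling :: "'a::field \<Rightarrow> nat \<Rightarrow> nat \<Rightarrow> 'a" where
  "qfalling q n r = (\<Prod>i<r. qint q (n - i))"

lemma finite_rook_placements: "finite (rook_placements m n r)"
  by (rule finite_subset[of _ "Pow ({..<m} \<times> {..<n})"]) (auto simp: rook_placements_def)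

lemma finite_rook_placement: "S \<in> rook_placements m n r \<Longrightarrow> finite S"
  by (auto simp: rook_placements_def intro: finite_subset)

lemma finite_inversions: "finite (inversions m n S)"
  by (rule finite_subset[of _ "{..<m} \<times> {..<n}"]) (auto simp: inversions_def)

lemma rook_placements_0_rooks: "rook_placements m n 0 = {{}}"
  by (auto simp: rook_placements_def dest: finite_subset)

lemma rook_placements_0_rows: "rook_placements 0 n (Suc r) = {}"
  by (auto simp: rook_placements_def)

section \<open>Removing the last row\<close>

lemma rook_placements_Suc_row:
  "rook_placements (Suc m) n (Suc r) =
     rook_placements m n (Suc r) \<union>
     (\<lambda>(T, j). insert (m, j) T) ` (SIGMA T:rook_placements m n r. {..<n} - snd ` T)"
  (is "?L = ?R1 \<union> ?f ` ?R2")
proof (intro equalityI subsetI)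
  fix S assume S: "S \<in> ?L"
  hence sub: "S \<subseteq> {..<Suc m} \<times> {..<n}" and fin: "finite S"
    and inj: "inj_on fst S" "inj_on snd S" and c: "card S = Suc r"
    using finite_rook_placement[OF S] by (auto simp: rook_placements_def)
  show "S \<in> ?R1 \<union> ?f ` ?R2"
  proof (cases "m \<in> fst ` S")
    case False
    have "S \<subseteq> {..<m} \<times> {..<n}"
    proof (rule subrelI)
      fix i j assume ij: "(i, j) \<in> S"
      have "i \<noteq> m"
        using False ij by (metis fst_conv image_eqI)
      thus "(i, j) \<in> {..<m} \<times> {..<n}"
        using ij sub by auto
    qed
    thus ?thesis
      using inj c by (auto simp: rook_placements_def)
  next
    case True
    then obtain j where j: "(m, j) \<in> S" by auto
    define T where "T = S - {(m, j)}"
    have "T \<subseteq> {..<m} \<times> {..<n}"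
    proof
      fix x assume x: "x \<in> T"
      have "fst x \<noteq> m"
        using x j inj_onD[OF inj(1), of x "(m, j)"] by (auto simp: T_def)
      thus "x \<in> {..<m} \<times> {..<n}"
        using x sub by (cases x) (auto simp: T_def less_Suc_eq)
    qed
    moreover have "inj_on fst T" "inj_on snd T"
      using inj by (simp_all add: T_def inj_on_diff)
    moreover have "card T = r"
      using c j fin by (simp add: T_def)
    ultimately have "T \<in> rook_placements m n r"
      by (simp add: rook_placements_def)
    moreover have "j \<notin> snd ` T"
      using j inj_onD[OF inj(2), of _ "(m, j)"] by (auto simp: T_def)
    moreover have "j < n" "S = ?f (T, j)"
      using j sub by (auto simp: T_def)
    ultimately have "S \<in> ?f ` ?R2"
      by (intro image_eqI[of _ _ "(T, j)"]) auto
    thus ?thesis ..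
  qed
next
  fix S assume "S \<in> ?R1 \<union> ?f ` ?R2"
  thus "S \<in> ?L"
  proof
    assume "S \<in> ?R1"
    thus ?thesis
      using lessThan_subset_iff[of m "Suc m"] by (auto simp: rook_placements_def)
  next
    assume "S \<in> ?f ` ?R2"
    then obtain T j where T: "T \<in> rook_placements m n r" and j: "j < n" "j \<notin> snd ` T"
      and S: "S = insert (m, j) T" by auto
    have "m \<notin> fst ` T"
      using T by (force simp: rook_placements_def)
    hence "inj_on fst S" "inj_on snd S" "(m, j) \<notin> T"
      using T j S by (auto simp: rook_placements_def)
    thus ?thesis
      using T j S finite_rook_placement[OF T] by (auto simp: rook_placements_def)
  qed
qed

text \<open>An entry of the empty row \<open>m\<close> could count only through a rook in its
  column, but that rook lies above and deletes it.\<close>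

lemma inversions_empty_row:
  assumes "T \<in> rook_placements m n r"
  shows "inversions (Suc m) n T = inversions m n T"
proof -
  have "T \<subseteq> {..<m} \<times> {..<n}"
    using assms by (simp add: rook_placements_def)
  hence "(m, j) \<notin> inversions (Suc m) n T" for j
    by (force simp: inversions_def)
  thus ?thesis
    by (auto simp: inversions_def less_Suc_eq)
qed

text \<open>The new rook creates inversions in two places: above it, in the rows without a rook
  (\<open>?A\<close>), and to its left, in the free columns (\<open>?B\<close>). All other entries
  keep their status.\<close>

lemma card_inversions_insert:
  assumes T: "T \<in> rook_placements m n r" and j: "j < n" "j \<notin> snd ` T"
  shows "card (inversions (Suc m) n (insert (m, j) T)) =
    card (inversions m n T) + (m - r) + card {j' \<in> {..<n} - snd ` T. j' < j}"
proof -
  let ?A = "({..<m} - fst ` T) \<times> {j}"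
  let ?B = "{m} \<times> {j' \<in> {..<n} - snd ` T. j' < j}"
  have sub: "T \<subseteq> {..<m} \<times> {..<n}" and inj: "inj_on fst T" and c: "card T = r"
    using T by (auto simp: rook_placements_def)
  have less: "i' < m" if "(i', j') \<in> T" for i' j'
    using that sub by auto
  have nT: "(i', j) \<notin> T" for i'
    using j by force
  have "x \<in> inversions (Suc m) n (insert (m, j) T) \<longleftrightarrow>
        x \<in> inversions m n T \<union> ?A \<union> ?B" for x
  proof (cases x)
    case (Pair a b)
    consider "a = m" | "a < m" "b = j" | "a < m" "b \<noteq> j" | "a > m"
      by linarith
    thus ?thesis
    proof cases
      case 1
      \<comment> \<open>In row \<open>m\<close>, occupied columns are deleted from above, and
        everything to the right of the rook is deleted by it.\<close>
      have "(m, b) \<in> inversions (Suc m) n (insert (m, j) T) \<longleftrightarrow> (m, b) \<in> ?B"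
        using less j by (force simp: inversions_def not_le intro: less_imp_le)
      thus ?thesis
        using 1 Pair by (auto simp: inversions_def)
    next
      case 2
      \<comment> \<open>With a rook at the foot of column \<open>j\<close>, the demand for a rook in
        the row or column is met automatically. Before the insertion only a rook in row
        \<open>a\<close> could meet it, so exactly the empty rows are gained.\<close>
      have "(a, j) \<in> inversions (Suc m) n (insert (m, j) T) \<longleftrightarrow> (\<forall>j'\<le>j. (a, j') \<notin> T)"
        using 2 j nT by (auto simp: inversions_def)
      moreover have "(a, j) \<in> inversions m n T \<longleftrightarrow> (\<forall>j'\<le>j. (a, j') \<notin> T) \<and> a \<in> fst ` T"
        using 2 j nT by (auto simp: inversions_def)
      moreover have "a \<notin> fst ` T \<Longrightarrow> (a, j') \<notin> T" for j'
        by force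
      ultimately show ?thesis
        using 2 Pair by blast
    next
      case 3
      thus ?thesis
        using Pair by (auto simp: inversions_def)
    next
      case 4
      thus ?thesis
        using Pair by (auto simp: inversions_def)
    qed
  qed
  hence eq: "inversions (Suc m) n (insert (m, j) T) = inversions m n T \<union> ?A \<union> ?B"
    by blast
  \<comment> \<open>An entry of \<open>?A\<close> has no rook of \<open>T\<close> in its row or
    column; \<open>?B\<close> lies in row \<open>m\<close>, the other two sets in rows below index
    \<open>m\<close>.\<close>
  have "inversions m n T \<inter> ?A = {}" "(inversions m n T \<union> ?A) \<inter> ?B = {}"
    using j by (auto simp: inversions_def)
  moreover have "card ?A = m - r"
  proof -
    have "card ({..<m} - fst ` T) = card {..<m} - card (fst ` T)"
      using sub finite_rook_placement[OF T] by (intro card_Diff_subset) auto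
    thus ?thesis
      using c inj by (simp add: card_image card_cartesian_product)
  qed
  moreover have "card ?B = card {j' \<in> {..<n} - snd ` T. j' < j}"
    by (simp add: card_cartesian_product)
  ultimately show ?thesis
    unfolding eq by (subst card_Un_disjoint card_Un_disjoint; simp add: finite_inversions)+
qed

text \<open>The exponent is the rank of \<open>j\<close> in \<open>U\<close>, and the ranks run
  through 0, ..., \<open>card U - 1\<close>. Adding a new maximum leaves the other ranks unchanged
  and contributes the rank \<open>card U\<close>.\<close>

lemma sum_power_rank:
  fixes U :: "nat set"
  assumes "finite U"
  shows "(\<Sum>j\<in>U. q ^ card {j' \<in> U. j' < j}) = qint q (card U)"
  using assms
proof (induction U rule: finite_linorder_max_induct)
  case empty
  thus ?case by (simp add: qint_def)
next
  case (insert b U)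
  have "{j' \<in> insert b U. j' < b} = U"
    using insert.hyps by auto
  moreover have "{j' \<in> insert b U. j' < j} = {j' \<in> U. j' < j}" if "j \<in> U" for j
    using insert.hyps that by auto
  moreover have "b \<notin> U"
    using insert.hyps by auto
  ultimately show ?case
    using insert by (simp add: qint_def add.commute)
qed

text \<open>The factor \<open>q ^ (m - r)\<close> comes from the empty rows,
  \<open>qint q (n - r)\<close> from the choice of a free column. If \<open>r > m\<close> or
  \<open>r > n\<close>, there are no placements of \<open>r\<close> rooks, so truncated subtraction
  does no harm.\<close>

lemma rook_sum_Suc_row:
  fixes q :: "'a::field"
  shows "rook_sum q (Suc m) n (Suc r) =
    rook_sum q m n (Suc r) + q ^ (m - r) * qint q (n - r) * rook_sum q m n r"
proof -
  let ?f = "\<lambda>(T, j). insert (m, j) T"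
  let ?R2 = "SIGMA T:rook_placements m n r. {..<n} - snd ` T"
  have notin: "(m, j) \<notin> T" if "T \<in> rook_placements m n s" for T j s
    using that by (auto simp: rook_placements_def)
  \<comment> \<open>The pair is recovered from the placement because \<open>(m, j)\<close> is its
    only rook in row \<open>m\<close>.\<close>
  have inj: "inj_on ?f ?R2"
  proof (rule inj_onI, clarify)
    fix T j T' j'
    assume T: "T \<in> rook_placements m n r" "T' \<in> rook_placements m n r"
      and eq: "insert (m, j) T = insert (m, j') T'"
    have "j = j'"
      using eq notin[OF T(2)] by blast
    thus "T = T' \<and> j = j'"
      using eq notin[OF T(1)] notin[OF T(2)] by (simp add: insert_ident)
  qed
  have disj: "rook_placements m n (Suc r) \<inter> ?f ` ?R2 = {}"
    using notin by auto
  have "rook_sum q (Suc m) n (Suc r) =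
      (\<Sum>S\<in>rook_placements m n (Suc r). q ^ card (inversions (Suc m) n S)) +
      (\<Sum>S\<in>?f ` ?R2. q ^ card (inversions (Suc m) n S))"
    unfolding rook_sum_def rook_placements_Suc_row
    by (intro sum.union_disjoint disj finite_imageI finite_SigmaI finite_rook_placements) auto
  also have "(\<Sum>S\<in>rook_placements m n (Suc r). q ^ card (inversions (Suc m) n S)) =
      rook_sum q m n (Suc r)"
    unfolding rook_sum_def by (intro sum.cong refl) (simp add: inversions_empty_row)
  also have "(\<Sum>S\<in>?f ` ?R2. q ^ card (inversions (Suc m) n S)) =
      (\<Sum>(T, j)\<in>?R2. q ^ card (inversions (Suc m) n (insert (m, j) T)))"
    by (subst sum.reindex[OF inj]) (simp add: case_prod_unfold)
  also have "\<dots> = (\<Sum>T\<in>rook_placements m n r. \<Sum>j\<in>{..<n} - snd ` T.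
      q ^ card (inversions (Suc m) n (insert (m, j) T)))"
    by (subst sum.Sigma) (auto simp: finite_rook_placements)
  also have "\<dots> = (\<Sum>T\<in>rook_placements m n r.
      q ^ (m - r) * qint q (n - r) * q ^ card (inversions m n T))"
  proof (rule sum.cong[OF refl])
    fix T assume T: "T \<in> rook_placements m n r"
    let ?U = "{..<n} - snd ` T"
    \<comment> \<open>Only the rank of \<open>j\<close> among the free columns depends on
      \<open>j\<close>; the other two powers are constant and leave the sum.\<close>
    have "(\<Sum>j\<in>?U. q ^ card (inversions (Suc m) n (insert (m, j) T))) =
        (\<Sum>j\<in>?U. q ^ (m - r) * q ^ card (inversions m n T) * q ^ card {j' \<in> ?U. j' < j})"
      using card_inversions_insert[OF T] by (intro sum.cong refl) (simp add: power_add mult_ac)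
    also have "\<dots> = q ^ (m - r) * q ^ card (inversions m n T) * qint q (card ?U)"
      using sum_power_rank[of ?U q] by (subst sum_distrib_left[symmetric]) auto
    also have "card ?U = card {..<n} - card (snd ` T)"
      using T finite_rook_placement[OF T]
      by (intro card_Diff_subset) (auto simp: rook_placements_def)
    also have "\<dots> = n - r"
      using T by (simp add: rook_placements_def card_image)
    finally show "(\<Sum>j\<in>?U. q ^ card (inversions (Suc m) n (insert (m, j) T))) =
        q ^ (m - r) * qint q (n - r) * q ^ card (inversions m n T)"
      by (simp add: mult_ac)
  qed
  also have "\<dots> = q ^ (m - r) * qint q (n - r) * rook_sum q m n r"
    by (simp add: rook_sum_def sum_distrib_left)
  finally show ?thesis .
qed

section \<open>Closed form through q-falling factorials\<close>

lemma qint_add: "qint q (m + n) = qint q m + q ^ m * qint q n"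
proof (induction n)
  case 0
  show ?case by (simp add: qint_def)
next
  case (Suc n)
  have "qint q (m + Suc n) = qint q (m + n) + q ^ m * q ^ n"
    by (simp add: qint_def power_add)
  also have "\<dots> = qint q m + q ^ m * (qint q n + q ^ n)"
    by (simp add: Suc distrib_left add.assoc)
  finally show ?case
    by (simp add: qint_def)
qed

lemma qfalling_Suc: "qfalling q n (Suc r) = qfalling q n r * qint q (n - r)"
  by (simp add: qfalling_def)

text \<open>This peels off the largest factor, \<open>qfalling_Suc\<close> the smallest; the
  induction for \<open>qfact_mult_rook_sum\<close> needs both.\<close>

lemma qfalling_Suc_Suc: "qfalling q (Suc n) (Suc r) = qint q (Suc n) * qfalling q n r"
  by (simp add: qfalling_def prod.lessThan_Suc_shift del: prod.lessThan_Suc)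

lemma qfalling_eq_0: "n < r \<Longrightarrow> qfalling q n r = 0"
  unfolding qfalling_def by (rule prod_zero) (auto simp: qint_def intro: bexI[of _ n])

lemma qfact_Suc: "qfact q (Suc n) = qfact q n * qint q (Suc n)"
  by (simp add: qfact_def)

lemma qfalling_mult_qfact:
  "r \<le> n \<Longrightarrow> qfalling q n r * qfact q (n - r) = qfact q n"
proof (induction r)
  case 0
  thus ?case by (simp add: qfalling_def)
next
  case (Suc r)
  hence "n - r = Suc (n - Suc r)" by simp
  thus ?case
    using Suc qfact_Suc[of q "n - Suc r"] by (simp add: qfalling_Suc mult_ac)
qed

text \<open>Stated without division, so that it holds for every \<open>q\<close>, even where
  \<open>qfact q r\<close> vanishes. The induction keeps \<open>r\<close> arbitrary because the
  recurrence also refers to one rook fewer.\<close>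

lemma qfact_mult_rook_sum:
  "qfact q r * rook_sum q m n r = qfalling q m r * qfalling q n r"
proof (induction m arbitrary: r)
  case 0
  show ?case
  proof (cases r)
    case 0
    thus ?thesis
      by (simp add: rook_sum_def rook_placements_0_rooks inversions_def qfact_def qfalling_def)
  next
    case (Suc s)
    thus ?thesis
      by (simp add: rook_sum_def rook_placements_0_rows qfalling_eq_0)
  qed
next
  case (Suc m)
  show ?case
  proof (cases r)
    case 0
    thus ?thesis
      by (simp add: rook_sum_def rook_placements_0_rooks inversions_def qfact_def qfalling_def)
  next
    case r: (Suc s)
    have "qfact q r * rook_sum q (Suc m) n r =
        qfact q (Suc s) * rook_sum q m n (Suc s) +
        q ^ (m - s) * qint q (n - s) * qint q (Suc s) * (qfact q s * rook_sum q m n s)"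
      by (simp add: r rook_sum_Suc_row qfact_Suc algebra_simps)
    \<comment> \<open>Both terms contain \<open>qfalling q n (Suc s)\<close>: in the second one
      \<open>qint q (n - s)\<close> completes \<open>qfalling q n s\<close>.\<close>
    also have "\<dots> = qfalling q n (Suc s) *
        (qfalling q m s * (qint q (m - s) + q ^ (m - s) * qint q (Suc s)))"
      by (simp add: Suc.IH qfalling_Suc algebra_simps)
    also have "qfalling q m s * (qint q (m - s) + q ^ (m - s) * qint q (Suc s)) =
        qfalling q (Suc m) (Suc s)"
    proof (cases "s \<le> m")
      case True
      hence "m - s + Suc s = Suc m" by simp
      hence "qint q (m - s) + q ^ (m - s) * qint q (Suc s) = qint q (Suc m)"
        by (metis qint_add)
      thus ?thesis by (simp add: qfalling_Suc_Suc)
    next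
      \<comment> \<open>Here the bracket is \<open>qint q (Suc s)\<close> instead of
        \<open>qint q (Suc m)\<close>, but both sides vanish since \<open>m < s\<close>.\<close>
      case False
      thus ?thesis by (simp add: qfalling_eq_0)
    qed
    finally show ?thesis by (simp add: r mult_ac)
  qed
qed

section \<open>From partial permutations to rook placements\<close>

definition one_positions :: "nat mat \<Rightarrow> (nat \<times> nat) set" where
  "one_positions A = {(i, j). i < dim_row A \<and> j < dim_col A \<and> A $$ (i, j) = 1}"

lemma inj_on_fst_one_positions:
  assumes "A \<in> carrier_mat n n"
  shows "inj_on fst (one_positions A) \<longleftrightarrow> (\<forall>i<n. card {j. j < n \<and> A $$ (i, j) = 1} \<le> 1)"
  using assms by (auto simp: card_le_Suc0_iff_eq inj_on_def one_positions_def)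

lemma inj_on_snd_one_positions:
  assumes "A \<in> carrier_mat n n"
  shows "inj_on snd (one_positions A) \<longleftrightarrow> (\<forall>j<n. card {i. i < n \<and> A $$ (i, j) = 1} \<le> 1)"
  using assms by (auto simp: card_le_Suc0_iff_eq inj_on_def one_positions_def)

lemma one_positions_subset:
  "A \<in> carrier_mat n n \<Longrightarrow> one_positions A \<subseteq> {..<n} \<times> {..<n}"
  by (auto simp: one_positions_def)

lemma finite_one_positions: "A \<in> carrier_mat n n \<Longrightarrow> finite (one_positions A)"
  using one_positions_subset finite_subset by blast

text \<open>A row of zeros and ones is nonzero iff it contains a 1, and distinct ones occupy
  distinct rows.\<close>

lemma card_zero_rows:
  assumes A: "A \<in> carrier_mat n n" and bin: "\<forall>i<n. \<forall>j<n. A $$ (i, j) \<in> {0, 1}"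
    and inj: "inj_on fst (one_positions A)"
  shows "card {i. i < n \<and> row A i = 0\<^sub>v n} = n - card (one_positions A)"
proof -
  have "row A i = 0\<^sub>v n \<longleftrightarrow> (\<forall>j<n. A $$ (i, j) \<noteq> 1)" if "i < n" for i
    using that A bin by (force simp: vec_eq_iff)
  hence "{i. i < n \<and> row A i = 0\<^sub>v n} = {..<n} - fst ` one_positions A"
    using A by (force simp: one_positions_def image_iff)
  moreover have "card \<dots> = card {..<n} - card (fst ` one_positions A)"
    using finite_one_positions[OF A] one_positions_subset[OF A]
    by (intro card_Diff_subset) auto
  ultimately show ?thesis
    using inj by (simp add: card_image)
qed

text \<open>This bound allows the truncated difference in \<open>card_zero_rows\<close> to be solved
  for the number of ones.\<close>

lemma card_one_positions_le:
  assumes "A \<in> carrier_mat n n" "inj_on fst (one_positions A)"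
  shows "card (one_positions A) \<le> n"
proof -
  have "card (fst ` one_positions A) \<le> card {..<n}"
    using one_positions_subset[OF assms(1)] by (intro card_mono) auto
  thus ?thesis
    using assms by (simp add: card_image)
qed

lemma pp_inv_eq_card_inversions:
  assumes A: "A \<in> carrier_mat n n" and bin: "\<forall>i<n. \<forall>j<n. A $$ (i, j) \<in> {0, 1}"
  shows "pp_inv A = card (inversions n n (one_positions A))"
proof -
  let ?S = "one_positions A"
  have dim: "dim_row A = n" "dim_col A = n" using A by auto
  have "(A $$ (i, j) = 0 \<and> \<not> deleted A i j \<and>
          ((\<exists>j'<n. A $$ (i, j') = 1) \<or> (\<exists>i'<n. A $$ (i', j) = 1))) \<longleftrightarrow>
        (\<forall>j'\<le>j. (i, j') \<notin> ?S) \<and> (\<forall>i'\<le>i. (i', j) \<notin> ?S) \<and> (i \<in> fst ` ?S \<or> j \<in> snd ` ?S)"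
    if "i < n" "j < n" for i j
  proof -
    have "A $$ (i, j) = 0 \<longleftrightarrow> A $$ (i, j) \<noteq> 1"
      using that bin by fastforce
    moreover have "(\<forall>j'\<le>j. (i, j') \<notin> ?S) \<longleftrightarrow> A $$ (i, j) \<noteq> 1 \<and> (\<forall>j'<j. A $$ (i, j') \<noteq> 1)"
      using that by (auto simp: one_positions_def dim le_less)
    moreover have "(\<forall>i'\<le>i. (i', j) \<notin> ?S) \<longleftrightarrow> A $$ (i, j) \<noteq> 1 \<and> (\<forall>i'<i. A $$ (i', j) \<noteq> 1)"
      using that by (auto simp: one_positions_def dim le_less)
    moreover have "i \<in> fst ` ?S \<longleftrightarrow> (\<exists>j'<n. A $$ (i, j') = 1)"
      using that by (force simp: one_positions_def dim image_iff)
    moreover have "j \<in> snd ` ?S \<longleftrightarrow> (\<exists>i'<n. A $$ (i', j) = 1)"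
      using that by (force simp: one_positions_def dim image_iff)
    ultimately show ?thesis
      unfolding deleted_def by (simp only:) blast
  qed
  thus ?thesis
    \<comment> \<open>\<open>conj_cong\<close> supplies the bounds on \<open>i\<close> and
      \<open>j\<close> under which the entrywise equivalence holds.\<close>
    unfolding pp_inv_def inversions_def dim by (simp only: cong: conj_cong)
qed

lemma bij_betw_one_positions:
  assumes "k \<le> n"
  shows "bij_betw one_positions (partial_perms n k) (rook_placements n n (n - k))"
\<comment> \<open>The inverse map sends a placement to its indicator matrix.\<close>
proof (rule bij_betw_byWitness[where f' = "\<lambda>S. mat n n (\<lambda>x. if x \<in> S then 1 else 0)"])
  let ?g = "\<lambda>S. mat n n (\<lambda>x. if x \<in> S then 1 else (0::nat))"
  show "\<forall>A\<in>partial_perms n k. ?g (one_positions A) = A"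
    by (intro ballI eq_matI) (auto simp: partial_perms_def one_positions_def, blast)
  have g: "one_positions (?g S) = S" if "S \<in> rook_placements n n (n - k)" for S
    using that by (auto simp: rook_placements_def one_positions_def split: if_splits)
  thus "\<forall>S\<in>rook_placements n n (n - k). one_positions (?g S) = S"
    by blast
  show "one_positions ` partial_perms n k \<subseteq> rook_placements n n (n - k)"
  proof clarify
    fix A assume "A \<in> partial_perms n k"
    hence A: "A \<in> carrier_mat n n" and bin: "\<forall>i<n. \<forall>j<n. A $$ (i, j) \<in> {0, 1}"
      and inj: "inj_on fst (one_positions A)" "inj_on snd (one_positions A)"
      and k: "card {i. i < n \<and> row A i = 0\<^sub>v n} = k"
      using inj_on_fst_one_positions[of A n] inj_on_snd_one_positions[of A n]
      by (simp_all add: partial_perms_def)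
    have "card (one_positions A) = n - k"
      using card_zero_rows[OF A bin inj(1)] card_one_positions_le[OF A inj(1)] k by simp
    thus "one_positions A \<in> rook_placements n n (n - k)"
      using inj one_positions_subset[OF A] by (simp add: rook_placements_def)
  qed
  show "?g ` rook_placements n n (n - k) \<subseteq> partial_perms n k"
  proof clarify
    fix S assume S: "S \<in> rook_placements n n (n - k)"
    have car: "?g S \<in> carrier_mat n n" by simp
    have bin: "\<forall>i<n. \<forall>j<n. ?g S $$ (i, j) \<in> {0, 1}" by simp
    have inj: "inj_on fst (one_positions (?g S))" "inj_on snd (one_positions (?g S))"
      using S by (simp_all only: g[OF S]) (simp_all add: rook_placements_def)
    \<comment> \<open>The number of zero rows is \<open>n - (n - k)\<close>, which is
      \<open>k\<close> because \<open>k \<le> n\<close>.\<close>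
    have "card {i. i < n \<and> row (?g S) i = 0\<^sub>v n} = k"
      using card_zero_rows[OF car bin inj(1)] S \<open>k \<le> n\<close>
      by (simp only: g[OF S]) (simp add: rook_placements_def)
    thus "?g S \<in> partial_perms n k"
      using car bin inj inj_on_fst_one_positions[OF car] inj_on_snd_one_positions[OF car]
      unfolding partial_perms_def by blast
  qed
qed

lemma sum_partial_perms_eq_rook_sum:
  assumes "k \<le> n"
  shows "(\<Sum>A\<in>partial_perms n k. q ^ pp_inv A) = rook_sum q n n (n - k)"
proof -
  have "(\<Sum>A\<in>partial_perms n k. q ^ pp_inv A) =
      (\<Sum>A\<in>partial_perms n k. q ^ card (inversions n n (one_positions A)))"
    by (intro sum.cong refl) (auto simp: partial_perms_def pp_inv_eq_card_inversions)
  also have "\<dots> = rook_sum q n n (n - k)"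
    unfolding rook_sum_def by (rule sum.reindex_bij_betw[OF bij_betw_one_positions[OF assms]])
  finally show ?thesis .
qed

text \<open>Only \<open>n\<close> rows are available. This case matches the convention that
  \<open>qbinom\<close> is 0 for \<open>k > n\<close>.\<close>

lemma partial_perms_eq_empty:
  assumes "n < k"
  shows "partial_perms n k = {}"
proof (rule equals0I)
  fix A assume "A \<in> partial_perms n k"
  hence "card {i. i < n \<and> row A i = 0\<^sub>v n} = k"
    by (simp add: partial_perms_def)
  moreover have "card {i. i < n \<and> row A i = 0\<^sub>v n} \<le> card {..<n}"
    by (rule card_mono) auto
  ultimately show False
    using assms by simp
qed

section \<open>Nonvanishing at the indeterminate and conclusion\<close>

lemma to_fract_power: "to_fract (x ^ n) = to_fract x ^ n"
  by (induction n) simp_all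

text \<open>The corresponding polynomial \<open>p\<close> has value 1 at 0, where only the term
  \<open>i = 0\<close> survives; being nonzero, it stays nonzero under the injective
  \<open>to_fract\<close>.\<close>

lemma qint_indet_neq_0: "n > 0 \<Longrightarrow> qint indet n \<noteq> 0"
proof -
  assume n: "n > 0"
  define p :: "int poly" where "p = (\<Sum>i<n. [:0, 1:] ^ i)"
  have "poly p 0 = (\<Sum>i<n. 0 ^ i)"
    by (simp add: p_def poly_sum)
  also have "\<dots> = 1"
    using n by (simp add: power_0_left)
  finally have "p \<noteq> 0" by auto
  moreover have "to_fract p = qint indet n"
    unfolding p_def qint_def indet_def by (induction n) (simp_all add: to_fract_power)
  ultimately show ?thesis
    by (metis to_fract_eq_0_iff)
qed

lemma qfact_indet_neq_0: "qfact indet n \<noteq> 0"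
  by (simp add: qfact_def qint_indet_neq_0)

theorem corollary3p3:
  fixes n k :: nat
  shows "(\<Sum>A\<in>partial_perms n k. indet ^ pp_inv A) = (qbinom indet n k)\<^sup>2 * qfact indet (n - k)"
proof (cases "k \<le> n")
  case True
  let ?q = indet
  have "qfalling ?q n (n - k) * qfact ?q k = qfact ?q n"
    using qfalling_mult_qfact[of "n - k" n ?q] True by simp
  hence falling: "qfalling ?q n (n - k) = qfact ?q n / qfact ?q k"
    using qfact_indet_neq_0 by (simp add: field_simps)
  \<comment> \<open>The board is square, so the two falling factorials coincide; division is
    legitimate by \<open>qfact_indet_neq_0\<close>.\<close>
  have "rook_sum ?q n n (n - k) = (qfalling ?q n (n - k))\<^sup>2 / qfact ?q (n - k)"
    using qfact_mult_rook_sum[of ?q "n - k" n n] qfact_indet_neq_0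
    by (simp add: field_simps power2_eq_square)
  \<comment> \<open>The squared binomial has \<open>qfact ?q (n - k)\<close> twice in its
    denominator; one copy cancels against the last factor of the claim.\<close>
  thus ?thesis
    unfolding falling
    using True qfact_indet_neq_0[of "n - k"]
    by (simp add: sum_partial_perms_eq_rook_sum qbinom_def field_simps power2_eq_square)
next
  case False
  thus ?thesis
    by (simp add: partial_perms_eq_empty qbinom_def)
qed

end
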